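(* Let $\mathcal{C}$ be the category whose objects are metric spaces and whose morphisms are locally Lipschitz maps. Then, for any weight $\omega$, the following functor is well defined: $$\mathrm{Ran}^\omega\colon\mathcal{C}\to\mathcal{C},\qquad (M,d)\mapsto(\mathrm{Ran}(M),d^\omega),\qquad \big(f\colon(M,d)\to(N,d')\big)\mapsto\big(\mathrm{Ran}(f)\colon X\mapsto f(X)\big);$$ in particular, for every locally Lipschitz map $f\colon(M,d)\to(N,d')$ the map $\mathrm{Ran}(f)\colon(\mathrm{Ran}(M),d^\omega)\to(\mathrm{Ran}(N),d'^{\,\omega})$ is locally Lipschitz. Furthermore, if $f\colon(M,d)\to(N,d')$ is a map in $\mathcal{C}$ which is injective, then $\mathrm{Ran}^\omega(f)$ is stratum preserving, i.e. $\mathrm{card}(f(X))=\mathrm{card}(X)$ for all $X\in\mathrm{Ran}(M)$.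
   Context: $\mathrm{Ran}(M)$ is the set of non-empty finite subsets of $M$. A weight is a non-decreasing function $\omega\colon\{1,2,\dots\}\to[1,\infty)$ with $\omega(1)=1$. A surjective relation from $X$ to $Y$ ($X,Y\in\mathrm{Ran}(M)$) is a subset $R\subset X\times Y$ projecting onto $X$ and onto $Y$; $\ell^\omega(R)=\omega(\mathrm{card}(R))\sum_{(x,y)\in R}d(x,y)$. A combinatorial chain from $X$ to $Y$ consists of $X=X_0,\dots,X_k=Y$ in $\mathrm{Ran}(M)$ and surjective relations $R_j$ from $X_j$ to $X_{j+1}$; its $\omega$-length is $\sum_j\ell^\omega(R_j)$. $d^\omega(X,Y)$ is the infimum of the $\omega$-lengths of combinatorial chains from $X$ to $Y$; it is a metric on $\mathrm{Ran}(M)$. For $(N,d')$, $d'^{\,\omega}$ is the metric on $\mathrm{Ran}(N)$ defined the same way from $d'$. A map between metric spaces is locally Lipschitz if every point of the source has a neighborhood on which the map is Lipschitz. *)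

theory Defs
  imports "HOL-Analysis.Analysis"
begin

definition Ran :: "'a set \<Rightarrow> 'a set set" where
  "Ran M = {X. X \<subseteq> M \<and> finite X \<and> X \<noteq> {}}"

text \<open>The value of a weight at \<open>0\<close> is irrelevant and left unconstrained.\<close>

definition weight :: "(nat \<Rightarrow> real) \<Rightarrow> bool" where
  "weight \<omega> \<longleftrightarrow> mono_on {1..} \<omega> \<and> (\<forall>n\<ge>1. \<omega> n \<ge> 1) \<and> \<omega> 1 = 1"

definition surjective_relation :: "'a set \<Rightarrow> 'a set \<Rightarrow> ('a \<times> 'a) set \<Rightarrow> bool" where
  "surjective_relation X Y R \<longleftrightarrow> R \<subseteq> X \<times> Y \<and> fst ` R = X \<and> snd ` R = Y"

definition rel_length :: "(nat \<Rightarrow> real) \<Rightarrow> ('a \<Rightarrow> 'a \<Rightarrow> real) \<Rightarrow> ('a \<times> 'a) set \<Rightarrow> real" where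
  "rel_length \<omega> d R = \<omega> (card R) * (\<Sum>(x,y)\<in>R. d x y)"

definition combinatorial_chain ::
    "'a set \<Rightarrow> 'a set \<Rightarrow> 'a set \<Rightarrow> nat \<Rightarrow> (nat \<Rightarrow> 'a set) \<Rightarrow> (nat \<Rightarrow> ('a \<times> 'a) set) \<Rightarrow> bool" where
  "combinatorial_chain M X Y k Xs Rs \<longleftrightarrow>
     Xs 0 = X \<and> Xs k = Y \<and> (\<forall>j\<le>k. Xs j \<in> Ran M) \<and>
     (\<forall>j<k. surjective_relation (Xs j) (Xs (Suc j)) (Rs j))"

definition chain_length ::
    "(nat \<Rightarrow> real) \<Rightarrow> ('a \<Rightarrow> 'a \<Rightarrow> real) \<Rightarrow> nat \<Rightarrow> (nat \<Rightarrow> ('a \<times> 'a) set) \<Rightarrow> real" where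
  "chain_length \<omega> d k Rs = (\<Sum>j<k. rel_length \<omega> d (Rs j))"

text \<open>
  The locale \<open>Metric_space\<close> requires non-negativity and symmetry also outside the carrier, where
  the infimum would range over the empty set; hence the default value \<open>0\<close> there.
  For \<open>X\<close>, \<open>Y\<close> in \<open>Ran M\<close> there is always a chain, e.g. the one given by \<open>X \<times> Y\<close>.
\<close>

definition ran_dist ::
    "(nat \<Rightarrow> real) \<Rightarrow> 'a set \<Rightarrow> ('a \<Rightarrow> 'a \<Rightarrow> real) \<Rightarrow> 'a set \<Rightarrow> 'a set \<Rightarrow> real" where
  "ran_dist \<omega> M d X Y =
     (if X \<in> Ran M \<and> Y \<in> Ran M
      then Inf {chain_length \<omega> d k Rs | k Xs Rs. combinatorial_chain M X Y k Xs Rs}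
      else 0)"

text \<open>
  As an element of the type of metric spaces, \<open>ran_metric \<omega> m\<close> is meaningful only once
  \<open>Metric_space (Ran (mspace m)) (ran_dist \<omega> (mspace m) (mdist m))\<close> is known.
\<close>

definition ran_metric :: "(nat \<Rightarrow> real) \<Rightarrow> 'a metric \<Rightarrow> 'a set metric" where
  "ran_metric \<omega> m = metric (Ran (mspace m), ran_dist \<omega> (mspace m) (mdist m))"

definition locally_Lipschitz_map :: "'a metric \<Rightarrow> 'b metric \<Rightarrow> ('a \<Rightarrow> 'b) \<Rightarrow> bool" where
  "locally_Lipschitz_map m1 m2 f \<longleftrightarrow> f \<in> mspace m1 \<rightarrow> mspace m2 \<and>
     (\<forall>x\<in>mspace m1. \<exists>U. openin (mtopology_of m1) U \<and> x \<in> U \<and>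
        Lipschitz_continuous_map (submetric m1 U) m2 f)"

text \<open>
  Morphisms of the category of metric spaces and locally Lipschitz maps. They are taken to be
  extensional functions on the carrier, so that equality of morphisms is equality of functions;
  the identity of \<open>m\<close> is \<open>\<lambda>x\<in>mspace m. x\<close> and composition is \<open>compose (mspace m)\<close>.
\<close>

definition lip_hom :: "'a metric \<Rightarrow> 'b metric \<Rightarrow> ('a \<Rightarrow> 'b) set" where
  "lip_hom m1 m2 = {f \<in> mspace m1 \<rightarrow>\<^sub>E mspace m2. locally_Lipschitz_map m1 m2 f}"

definition ran_map :: "'a metric \<Rightarrow> ('a \<Rightarrow> 'b) \<Rightarrow> 'a set \<Rightarrow> 'b set" where
  "ran_map m f = (\<lambda>X\<in>Ran (mspace m). f ` X)"

end

theory Submission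
  imports Defs
begin

text \<open>
  Two facts about a combinatorial chain of \<open>\<omega>\<close>-length \<open>L\<close> carry the proof.

  First, no point moves further than \<open>L\<close>: since \<open>\<omega> \<ge> 1\<close>, each related pair \<open>(x, y) \<in> R\<close> satisfies
  \<open>d x y \<le> rel_length \<omega> d R\<close>, and since the relations are surjective every point occurring in the
  chain can be traced back to a point of the initial set (\<open>chain_traceback\<close>). So the distance
  \<open>ran_dist\<close> dominates the Hausdorff distance, and distinct finite sets have positive distance. The
  other metric axioms come from trivial, reversed and concatenated chains.

  Second, \<open>f\<close> maps chains to chains, and if \<open>f\<close> stretches each related pair by at most a factor
  \<open>K\<close>, then the \<open>\<omega>\<close>-length grows at most by the factor \<open>K\<close>: passing to the image of a relation can
  only decrease its cardinality, hence its weight, as \<open>\<omega>\<close> is non-decreasing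
  (\<open>rel_length_image_le\<close>).

  Together they give the local Lipschitz property. Given \<open>X\<close>, finiteness of \<open>X\<close> yields common \<open>r\<close> and
  \<open>K\<close> such that \<open>f\<close> is \<open>K\<close>-Lipschitz on the ball of radius \<open>r\<close> about each point of \<open>X\<close>. If \<open>Y\<close> and
  \<open>Z\<close> lie within \<open>r / 4\<close> of \<open>X\<close>, then only chains from \<open>Y\<close> to \<open>Z\<close> shorter than \<open>r / 2\<close> matter, and
  by the first fact any pair related in such a chain lies in one of these balls; by the second fact
  the distance of \<open>f ` Y\<close> and \<open>f ` Z\<close> is at most \<open>K\<close> times that of \<open>Y\<close> and \<open>Z\<close>.

  That locally Lipschitz maps form a category is the usual argument with balls, and the functor laws
  hold because images of sets respect identity and composition.
\<close>

section \<open>Relations and chains\<close>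

lemma surjective_relation_finite_nonempty:
  assumes "surjective_relation X Y R" "X \<in> Ran M" "Y \<in> Ran N"
  shows "finite R" "R \<noteq> {}"
proof -
  have "R \<subseteq> X \<times> Y" "finite (X \<times> Y)" "fst ` R = X" "X \<noteq> {}"
    using assms by (auto simp: surjective_relation_def Ran_def)
  then show "finite R" "R \<noteq> {}"
    by (auto intro: finite_subset)
qed

lemma weight_ge_1:
  assumes "weight \<omega>" "finite R" "R \<noteq> {}"
  shows "1 \<le> \<omega> (card R)"
  using assms by (simp add: weight_def card_gt_0_iff Suc_le_eq)

lemma surjective_relation_converse:
  "surjective_relation X Y R \<Longrightarrow> surjective_relation Y X (R\<inverse>)"
  unfolding surjective_relation_def fst_eq_Domain snd_eq_Range by auto

lemma surjective_relation_image:
  "surjective_relation X Y R \<Longrightarrow> surjective_relation (f ` X) (f ` Y) (map_prod f f ` R)"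
proof -
  assume "surjective_relation X Y R"
  then have R: "R \<subseteq> X \<times> Y" "fst ` R = X" "snd ` R = Y"
    by (simp_all add: surjective_relation_def)
  have "fst ` map_prod f f ` R = f ` fst ` R" "snd ` map_prod f f ` R = f ` snd ` R"
    by (simp_all add: image_image)
  moreover have "map_prod f f ` R \<subseteq> (f ` X) \<times> (f ` Y)"
    using R(1) by auto
  ultimately show ?thesis by (simp add: surjective_relation_def R(2,3))
qed

lemma combinatorial_chainD:
  assumes "combinatorial_chain M X Y k Xs Rs" "j < k"
  shows "surjective_relation (Xs j) (Xs (Suc j)) (Rs j)"
    and "Xs j \<in> Ran M" "Xs (Suc j) \<in> Ran M"
    and "finite (Rs j)" "Rs j \<noteq> {}"
proof -
  show *: "surjective_relation (Xs j) (Xs (Suc j)) (Rs j)" "Xs j \<in> Ran M" "Xs (Suc j) \<in> Ran M"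
    using assms by (auto simp: combinatorial_chain_def)
  show "finite (Rs j)" "Rs j \<noteq> {}"
    using surjective_relation_finite_nonempty[OF *] by auto
qed

lemma combinatorial_chain_prefix:
  "combinatorial_chain M X Y k Xs Rs \<Longrightarrow> j \<le> k \<Longrightarrow> combinatorial_chain M X (Xs j) j Xs Rs"
  by (auto simp: combinatorial_chain_def)

lemma combinatorial_chain_Times:
  assumes "X \<in> Ran M" "Y \<in> Ran M"
  shows "combinatorial_chain M X Y 1 (\<lambda>j. if j = 0 then X else Y) (\<lambda>_. X \<times> Y)"
  using assms by (auto simp: combinatorial_chain_def surjective_relation_def Ran_def)

lemma combinatorial_chain_rev:
  assumes "combinatorial_chain M X Y k Xs Rs"
  shows "combinatorial_chain M Y X k (\<lambda>j. Xs (k - j)) (\<lambda>j. (Rs (k - Suc j))\<inverse>)"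
  unfolding combinatorial_chain_def
proof (intro conjI allI impI)
  fix j assume "j < k"
  then have "Suc (k - Suc j) = k - j" "k - Suc j < k" by auto
  then show "surjective_relation (Xs (k - j)) (Xs (k - Suc j)) ((Rs (k - Suc j))\<inverse>)"
    using combinatorial_chainD(1)[OF assms, of "k - Suc j"] by (simp add: surjective_relation_converse)
qed (use assms in \<open>auto simp: combinatorial_chain_def\<close>)

lemma combinatorial_chain_append:
  assumes "combinatorial_chain M X Y k Xs Rs" "combinatorial_chain M Y Z l Xs' Rs'"
  shows "combinatorial_chain M X Z (k + l)
           (\<lambda>j. if j < k then Xs j else Xs' (j - k)) (\<lambda>j. if j < k then Rs j else Rs' (j - k))"
  unfolding combinatorial_chain_def
proof (intro conjI allI impI)
  fix j assume j: "j < k + l"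
  show "surjective_relation (if j < k then Xs j else Xs' (j - k))
      (if Suc j < k then Xs (Suc j) else Xs' (Suc j - k)) (if j < k then Rs j else Rs' (j - k))"
  proof (cases "j < k")
    case True
    have "Xs k = Xs' 0" using assms by (simp add: combinatorial_chain_def)
    then have "(if Suc j < k then Xs (Suc j) else Xs' (Suc j - k)) = Xs (Suc j)"
      using True by (cases "Suc j = k") auto
    moreover have "surjective_relation (Xs j) (Xs (Suc j)) (Rs j)"
      using combinatorial_chainD(1)[OF assms(1) True] .
    ultimately show ?thesis by (simp only: True if_True)
  next
    case False
    then show ?thesis
      using j combinatorial_chainD(1)[OF assms(2), of "j - k"] by (auto simp: Suc_diff_le)
  qed
next
  have ends: "Xs 0 = X" "Xs k = Y" "Xs' 0 = Y" "Xs' l = Z"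
    using assms by (simp_all add: combinatorial_chain_def)
  show "(if 0 < k then Xs 0 else Xs' (0 - k)) = X"
    using ends by (cases "k = 0") auto
  show "(if k + l < k then Xs (k + l) else Xs' (k + l - k)) = Z"
    using ends by simp
  fix j assume "j \<le> k + l"
  then have "j - k \<le> l" by simp
  then show "(if j < k then Xs j else Xs' (j - k)) \<in> Ran M"
    using assms by (simp add: combinatorial_chain_def)
qed

lemma combinatorial_chain_image:
  assumes "combinatorial_chain M X Y k Xs Rs" "f \<in> M \<rightarrow> N"
  shows "combinatorial_chain N (f ` X) (f ` Y) k (\<lambda>j. f ` Xs j) (\<lambda>j. map_prod f f ` Rs j)"
proof -
  have "f ` A \<in> Ran N" if "A \<in> Ran M" for A
    using that assms(2) by (auto simp: Ran_def)
  then show ?thesis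
    using assms(1) unfolding combinatorial_chain_def
    by (blast intro: surjective_relation_image)
qed

lemma chain_length_rev:
  assumes "\<And>x y. d x y = d y x"
  shows "chain_length \<omega> d k (\<lambda>j. (Rs (k - Suc j))\<inverse>) = chain_length \<omega> d k Rs"
proof -
  have "rel_length \<omega> d (R\<inverse>) = rel_length \<omega> d R" for R
  proof -
    have "(\<Sum>(x,y)\<in>R\<inverse>. d x y) = (\<Sum>(x,y)\<in>R. d x y)"
      by (rule sum.reindex_bij_witness[where i = prod.swap and j = prod.swap]) (auto simp: assms)
    then show ?thesis by (simp add: rel_length_def)
  qed
  then show ?thesis
    by (simp add: chain_length_def sum.nat_diff_reindex[where g = "\<lambda>j. rel_length \<omega> d (Rs j)"])
qed

lemma chain_length_append:
  "chain_length \<omega> d (k + l) (\<lambda>j. if j < k then Rs j else Rs' (j - k))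
     = chain_length \<omega> d k Rs + chain_length \<omega> d l Rs'"
  unfolding chain_length_def by (induction l) auto

section \<open>The metric on finite subsets\<close>

context Metric_space
begin

lemma rel_length_nonneg:
  assumes "weight \<omega>" "finite R" "R \<noteq> {}"
  shows "0 \<le> rel_length \<omega> d R"
  using weight_ge_1[OF assms] unfolding rel_length_def
  by (intro mult_nonneg_nonneg sum_nonneg) auto

lemma dist_le_rel_length:
  assumes "weight \<omega>" "finite R" "(x, y) \<in> R"
  shows "d x y \<le> rel_length \<omega> d R"
proof -
  have "d x y \<le> (\<Sum>(x,y)\<in>R. d x y)"
    using member_le_sum[OF assms(3), of "\<lambda>(x,y). d x y"] assms(2) by auto
  also have "\<dots> \<le> \<omega> (card R) * (\<Sum>(x,y)\<in>R. d x y)"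
    using weight_ge_1[of \<omega> R] assms mult_right_mono[of 1 "\<omega> (card R)" "\<Sum>(x,y)\<in>R. d x y"]
    by (auto simp: sum_nonneg case_prod_unfold)
  finally show ?thesis by (simp add: rel_length_def)
qed

lemma chain_length_mono:
  assumes "weight \<omega>" "combinatorial_chain M X Y k Xs Rs" "j \<le> k"
  shows "chain_length \<omega> d j Rs \<le> chain_length \<omega> d k Rs"
  unfolding chain_length_def using assms
  by (intro sum_mono2) (auto intro!: rel_length_nonneg dest: combinatorial_chainD(4,5))

text \<open>
  Every point of a chain is reached from the initial set by a sequence of successively related
  points, which by the triangle inequality is no longer than the chain up to that point.
\<close>

lemma chain_traceback:
  assumes "weight \<omega>" "combinatorial_chain M X Y k Xs Rs" "y \<in> Y"
  shows "\<exists>x\<in>X. d x y \<le> chain_length \<omega> d k Rs"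
  using assms(2,3)
proof (induction k arbitrary: Y y)
  case 0
  then have "y \<in> X" "y \<in> M" by (auto simp: combinatorial_chain_def Ran_def)
  then show ?case by (intro bexI[of _ y]) (simp_all add: chain_length_def)
next
  case (Suc k)
  note step = combinatorial_chainD[OF Suc.prems(1), of k]
  have Y: "Y = Xs (Suc k)" using Suc.prems(1) by (simp add: combinatorial_chain_def)
  then obtain u where u: "(u, y) \<in> Rs k" "u \<in> Xs k"
    using step(1) Suc.prems(2) by (force simp: surjective_relation_def)
  obtain x where x: "x \<in> X" "d x u \<le> chain_length \<omega> d k Rs"
    using Suc.IH[OF combinatorial_chain_prefix[OF Suc.prems(1)] u(2)] by auto
  have "X \<in> Ran M" using Suc.prems(1) by (auto simp: combinatorial_chain_def)
  then have "x \<in> M" "u \<in> M" "y \<in> M"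
    using Suc.prems(2) x(1) u(2) step(2,3) by (auto simp: Y Ran_def)
  then have "d x y \<le> d x u + d u y" by (rule triangle)
  also have "\<dots> \<le> chain_length \<omega> d (Suc k) Rs"
    using x(2) dist_le_rel_length[OF assms(1) step(4) u(1)] by (simp add: chain_length_def)
  finally show ?case using x(1) by blast
qed

lemma chain_length_nonneg:
  assumes "weight \<omega>" "combinatorial_chain M X Y k Xs Rs"
  shows "0 \<le> chain_length \<omega> d k Rs"
  using chain_length_mono[OF assms, of 0] by (simp add: chain_length_def)

lemma ran_dist_le_chain_length:
  assumes "weight \<omega>" "combinatorial_chain M X Y k Xs Rs"
  shows "ran_dist \<omega> M d X Y \<le> chain_length \<omega> d k Rs"
proof -
  have "X \<in> Ran M" "Y \<in> Ran M" using assms(2) by (auto simp: combinatorial_chain_def)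
  moreover have "bdd_below {chain_length \<omega> d k Rs | k Xs Rs. combinatorial_chain M X Y k Xs Rs}"
    using chain_length_nonneg[OF assms(1)] by (intro bdd_belowI[of _ 0]) auto
  ultimately show ?thesis
    unfolding ran_dist_def using assms(2) by (auto intro!: cInf_lower)
qed

lemma ran_dist_lessE:
  assumes "X \<in> Ran M" "Y \<in> Ran M" "ran_dist \<omega> M d X Y < c"
  obtains k Xs Rs where "combinatorial_chain M X Y k Xs Rs" "chain_length \<omega> d k Rs < c"
proof -
  let ?L = "{chain_length \<omega> d k Rs | k Xs Rs. combinatorial_chain M X Y k Xs Rs}"
  have "?L \<noteq> {}"
    using combinatorial_chain_Times[OF assms(1,2)] by blast
  moreover have "Inf ?L < c"
    using assms unfolding ran_dist_def by (simp only: if_True simp_thms)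
  ultimately have "\<exists>l\<in>?L. l < c"
    by (rule cInf_lessD)
  then obtain l where "l \<in> ?L" "l < c" ..
  then obtain k Xs Rs where "combinatorial_chain M X Y k Xs Rs" "l = chain_length \<omega> d k Rs"
    by blast
  with \<open>l < c\<close> show thesis by (intro that[of k Xs Rs]) simp_all
qed

lemma ran_dist_nonneg:
  assumes "weight \<omega>"
  shows "0 \<le> ran_dist \<omega> M d X Y"
proof (rule ccontr)
  assume neg: "\<not> 0 \<le> ran_dist \<omega> M d X Y"
  then have XY: "X \<in> Ran M" "Y \<in> Ran M" by (auto simp: ran_dist_def split: if_splits)
  have "ran_dist \<omega> M d X Y < 0" using neg by simp
  then obtain k Xs Rs where c: "combinatorial_chain M X Y k Xs Rs" "chain_length \<omega> d k Rs < 0"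
    by (rule ran_dist_lessE[OF XY])
  then show False using chain_length_nonneg[OF assms c(1)] by simp
qed

lemma ran_dist_commute_le:
  assumes "weight \<omega>"
  shows "ran_dist \<omega> M d Y X \<le> ran_dist \<omega> M d X Y"
proof (cases "X \<in> Ran M \<and> Y \<in> Ran M")
  case True
  then have XY: "X \<in> Ran M" "Y \<in> Ran M" by auto
  show ?thesis
  proof (rule dense_ge)
    fix c assume "ran_dist \<omega> M d X Y < c"
    then obtain k Xs Rs where c: "combinatorial_chain M X Y k Xs Rs" "chain_length \<omega> d k Rs < c"
      by (rule ran_dist_lessE[OF XY])
    then show "ran_dist \<omega> M d Y X \<le> c"
      using ran_dist_le_chain_length[OF assms combinatorial_chain_rev[OF c(1)]]
        c(2) by (simp add: chain_length_rev[of d, OF commute])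
  qed
qed (auto simp: ran_dist_def)

lemma ran_dist_triangle:
  assumes "weight \<omega>" "X \<in> Ran M" "Y \<in> Ran M" "Z \<in> Ran M"
  shows "ran_dist \<omega> M d X Z \<le> ran_dist \<omega> M d X Y + ran_dist \<omega> M d Y Z"
proof (rule field_le_epsilon)
  fix e :: real assume "0 < e"
  then have less: "ran_dist \<omega> M d X Y < ran_dist \<omega> M d X Y + e / 2"
    "ran_dist \<omega> M d Y Z < ran_dist \<omega> M d Y Z + e / 2"
    by auto
  obtain k Xs Rs where 1: "combinatorial_chain M X Y k Xs Rs"
      "chain_length \<omega> d k Rs < ran_dist \<omega> M d X Y + e / 2"
    by (rule ran_dist_lessE[OF assms(2,3) less(1)])
  obtain l Xs' Rs' where 2: "combinatorial_chain M Y Z l Xs' Rs'"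
      "chain_length \<omega> d l Rs' < ran_dist \<omega> M d Y Z + e / 2"
    by (rule ran_dist_lessE[OF assms(3,4) less(2)])
  have "ran_dist \<omega> M d X Z \<le> chain_length \<omega> d k Rs + chain_length \<omega> d l Rs'"
    using ran_dist_le_chain_length[OF assms(1) combinatorial_chain_append[OF 1(1) 2(1)]]
    by (simp add: chain_length_append)
  then show "ran_dist \<omega> M d X Z \<le> ran_dist \<omega> M d X Y + ran_dist \<omega> M d Y Z + e"
    using 1(2) 2(2) by linarith
qed

text \<open>
  One half of the statement that \<open>ran_dist\<close> dominates the Hausdorff distance; the other half is
  the same with \<open>X\<close> and \<open>Y\<close> exchanged.
\<close>

lemma ran_dist_less_imp_close:
  assumes "weight \<omega>" "X \<in> Ran M" "Y \<in> Ran M" "ran_dist \<omega> M d X Y < c" "y \<in> Y"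
  shows "\<exists>x\<in>X. d x y < c"
proof -
  obtain k Xs Rs where c: "combinatorial_chain M X Y k Xs Rs" "chain_length \<omega> d k Rs < c"
    by (rule ran_dist_lessE[OF assms(2-4)])
  show ?thesis using chain_traceback[OF assms(1) c(1) assms(5)] c(2) by force
qed

text \<open>
  A point \<open>y \<in> Y\<close> outside the finite set \<open>X\<close> would have positive distance from \<open>X\<close>, contrary to being
  arbitrarily close to it.
\<close>

lemma ran_dist_zero_imp_subset:
  assumes "weight \<omega>" "X \<in> Ran M" "Y \<in> Ran M" "ran_dist \<omega> M d X Y = 0"
  shows "Y \<subseteq> X"
proof
  fix y assume y: "y \<in> Y"
  have X: "finite X" "X \<noteq> {}" "X \<subseteq> M" "y \<in> M"
    using assms y by (auto simp: Ran_def)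
  show "y \<in> X"
  proof (rule ccontr)
    assume "y \<notin> X"
    define c where "c = Min ((\<lambda>x. d x y) ` X)"
    have "0 < d x y" if "x \<in> X" for x
      using that X \<open>y \<notin> X\<close> by (metis mdist_pos_less subsetD)
    then have "0 < c" using X by (auto simp: c_def)
    then obtain x where "x \<in> X" "d x y < c"
      using ran_dist_less_imp_close[OF assms(1-3) _ y] assms(4) by force
    moreover have "c \<le> d x y" using X \<open>x \<in> X\<close> by (auto simp: c_def)
    ultimately show False by simp
  qed
qed

lemma Metric_space_ran_dist:
  assumes "weight \<omega>"
  shows "Metric_space (Ran M) (ran_dist \<omega> M d)"
proof
  show "ran_dist \<omega> M d X Y = ran_dist \<omega> M d Y X" for X Y
    using ran_dist_commute_le[OF assms] by (metis order_antisym)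
  then show "ran_dist \<omega> M d X Y = 0 \<longleftrightarrow> X = Y" if "X \<in> Ran M" "Y \<in> Ran M" for X Y
  proof -
    \<comment> \<open>The chain with no relation has length \<open>0\<close>.\<close>
    have "ran_dist \<omega> M d X X \<le> 0"
      using ran_dist_le_chain_length[OF assms, of X X 0 "\<lambda>_. X" "\<lambda>_. {}"] that
      by (simp add: combinatorial_chain_def chain_length_def)
    then have "ran_dist \<omega> M d X X = 0"
      using ran_dist_nonneg[OF assms, of X X] by linarith
    moreover have "X = Y" if "ran_dist \<omega> M d X Y = 0"
      using ran_dist_zero_imp_subset[OF assms] \<open>X \<in> Ran M\<close> \<open>Y \<in> Ran M\<close> that
        \<open>ran_dist \<omega> M d X Y = ran_dist \<omega> M d Y X\<close> by (metis subset_antisym)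
    ultimately show ?thesis by blast
  qed
qed (simp_all add: assms ran_dist_nonneg ran_dist_triangle)

end

lemma
  assumes "weight \<omega>"
  shows mspace_ran_metric: "mspace (ran_metric \<omega> M) = Ran (mspace M)"
    and mdist_ran_metric: "mdist (ran_metric \<omega> M) = ran_dist \<omega> (mspace M) (mdist M)"
  using Metric_space.Metric_space_ran_dist[OF Metric_space_mspace_mdist assms, of M]
  by (simp_all add: ran_metric_def Metric_space.mspace_metric Metric_space.mdist_metric)

section \<open>Locally Lipschitz maps\<close>

lemma locally_Lipschitz_map_iff_mball:
  "locally_Lipschitz_map M N f \<longleftrightarrow> f \<in> mspace M \<rightarrow> mspace N \<and>
     (\<forall>x\<in>mspace M. \<exists>r>0. \<exists>K>0. \<forall>y\<in>mball_of M x r. \<forall>z\<in>mball_of M x r.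
        mdist N (f y) (f z) \<le> K * mdist M y z)" (is "_ \<longleftrightarrow> ?maps \<and> ?balls")
proof
  assume L: "locally_Lipschitz_map M N f"
  show "?maps \<and> ?balls"
  proof (intro conjI ballI)
    show ?maps using L by (simp add: locally_Lipschitz_map_def)
    fix x assume "x \<in> mspace M"
    then obtain U where U: "openin (mtopology_of M) U" "x \<in> U"
      "Lipschitz_continuous_map (submetric M U) N f"
      using L by (auto simp: locally_Lipschitz_map_def)
    obtain K where K: "K > 0"
      "\<And>y z. y \<in> U \<inter> mspace M \<Longrightarrow> z \<in> U \<inter> mspace M \<Longrightarrow> mdist N (f y) (f z) \<le> K * mdist M y z"
      using U(3) by (auto simp: Lipschitz_continuous_map_pos)
    obtain r where "r > 0" "mball_of M x r \<subseteq> U"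
      using U(1,2) by (auto simp: mtopology_of_def mball_of_def Metric_space.openin_mtopology)
    then show "\<exists>r>0. \<exists>K>0. \<forall>y\<in>mball_of M x r. \<forall>z\<in>mball_of M x r.
        mdist N (f y) (f z) \<le> K * mdist M y z"
      using K by (metis IntI in_mball_of subsetD)
  qed
next
  assume R: "?maps \<and> ?balls"
  show "locally_Lipschitz_map M N f"
    unfolding locally_Lipschitz_map_def
  proof (intro conjI ballI)
    fix x assume x: "x \<in> mspace M"
    then obtain r K where rK: "r > 0" "\<And>y z. y \<in> mball_of M x r \<Longrightarrow> z \<in> mball_of M x r \<Longrightarrow>
        mdist N (f y) (f z) \<le> K * mdist M y z"
      using R by meson
    have "openin (mtopology_of M) (mball_of M x r)"
      by (simp add: mtopology_of_def mball_of_def Metric_space.openin_mball)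
    moreover have "Lipschitz_continuous_map (submetric M (mball_of M x r)) N f"
      using R rK(2) unfolding Lipschitz_continuous_map_def mspace_submetric mdist_submetric by blast
    ultimately show "\<exists>U. openin (mtopology_of M) U \<and> x \<in> U \<and>
        Lipschitz_continuous_map (submetric M U) N f"
      using x rK(1) by (metis in_mball_of mdist_zero)
  qed (use R in blast)
qed

lemma lip_hom_ident: "(\<lambda>x\<in>mspace M. x) \<in> lip_hom M M"
proof -
  have "\<exists>r>0. \<exists>K>0. \<forall>y\<in>mball_of M x r. \<forall>z\<in>mball_of M x r.
      mdist M ((\<lambda>x\<in>mspace M. x) y) ((\<lambda>x\<in>mspace M. x) z) \<le> K * mdist M y z" for x
    by (intro exI[of _ 1] conjI) auto
  then show ?thesis
    by (auto simp: lip_hom_def locally_Lipschitz_map_iff_mball)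
qed

lemma lip_hom_compose:
  assumes f: "f \<in> lip_hom M N" and g: "g \<in> lip_hom N P"
  shows "compose (mspace M) g f \<in> lip_hom M P"
proof -
  have maps: "f \<in> mspace M \<rightarrow> mspace N" "g \<in> mspace N \<rightarrow> mspace P"
    using f g by (auto simp: lip_hom_def)
  have "\<exists>r>0. \<exists>K>0. \<forall>y\<in>mball_of M x r. \<forall>z\<in>mball_of M x r.
      mdist P (compose (mspace M) g f y) (compose (mspace M) g f z) \<le> K * mdist M y z"
    if x: "x \<in> mspace M" for x
  proof -
    have "f x \<in> mspace N" using maps x by auto
    obtain r K where rK: "r > 0" "K > 0" "\<And>y z. y \<in> mball_of M x r \<Longrightarrow> z \<in> mball_of M x r \<Longrightarrow>
        mdist N (f y) (f z) \<le> K * mdist M y z"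
      using f x unfolding lip_hom_def locally_Lipschitz_map_iff_mball by blast
    obtain s L where sL: "s > 0" "L > 0" "\<And>y z. y \<in> mball_of N (f x) s \<Longrightarrow> z \<in> mball_of N (f x) s \<Longrightarrow>
        mdist P (g y) (g z) \<le> L * mdist N y z"
      using g \<open>f x \<in> mspace N\<close> unfolding lip_hom_def locally_Lipschitz_map_iff_mball by blast
    \<comment> \<open>On the ball of radius \<open>s / K\<close> the map \<open>f\<close> stays within the ball on which \<open>g\<close> is Lipschitz.\<close>
    define t where "t = min r (s / K)"
    have t: "y \<in> mball_of M x r" "f y \<in> mball_of N (f x) s" if "y \<in> mball_of M x t" for y
    proof -
      show y: "y \<in> mball_of M x r" using that by (simp add: t_def)
      have "x \<in> mball_of M x r" using rK(1) x by (metis in_mball_of mdist_zero)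
      then have "mdist N (f x) (f y) \<le> K * mdist M x y" using y by (rule rK(3))
      also have "\<dots> < s" using that rK(2) by (simp add: t_def field_simps)
      finally show "f y \<in> mball_of N (f x) s" using maps that x by auto
    qed
    have "mdist P (compose (mspace M) g f y) (compose (mspace M) g f z) \<le> (L * K) * mdist M y z"
      if y: "y \<in> mball_of M x t" and z: "z \<in> mball_of M x t" for y z
    proof -
      have "mdist P (g (f y)) (g (f z)) \<le> L * mdist N (f y) (f z)"
        using t y z by (intro sL(3)) auto
      also have "\<dots> \<le> L * (K * mdist M y z)"
        using t y z sL(2) by (intro mult_left_mono rK(3)) auto
      finally show ?thesis using y z by (simp add: compose_def mult.assoc)
    qed
    moreover have "t > 0" "L * K > 0" using rK(1,2) sL(1,2) by (auto simp: t_def)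
    ultimately show ?thesis by blast
  qed
  then show ?thesis
    using maps by (auto simp: lip_hom_def locally_Lipschitz_map_iff_mball compose_def)
qed

text \<open>
  Finitely many local radii and constants are replaced by their minimum and maximum. The bound is
  stated for each ball separately because pairs related in a short chain lie in a common ball.
\<close>

lemma locally_Lipschitz_map_finite_uniform:
  assumes "locally_Lipschitz_map M N f" "finite X" "X \<subseteq> mspace M"
  shows "\<exists>r>0. \<exists>K>0. \<forall>x\<in>X. \<forall>y\<in>mball_of M x r. \<forall>z\<in>mball_of M x r.
           mdist N (f y) (f z) \<le> K * mdist M y z"
  using assms(2,3)
proof (induction X rule: finite_induct)
  case empty
  show ?case by (intro exI[of _ 1] conjI) auto
next
  case (insert a X)
  obtain r K where 1: "r > 0" "K > 0" "\<And>x y z. x \<in> X \<Longrightarrow> y \<in> mball_of M x r \<Longrightarrow>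
      z \<in> mball_of M x r \<Longrightarrow> mdist N (f y) (f z) \<le> K * mdist M y z"
    using insert.IH insert.prems by (metis insert_subset)
  obtain s L where 2: "s > 0" "L > 0" "\<And>y z. y \<in> mball_of M a s \<Longrightarrow>
      z \<in> mball_of M a s \<Longrightarrow> mdist N (f y) (f z) \<le> L * mdist M y z"
    using assms(1) insert.prems unfolding locally_Lipschitz_map_iff_mball by (metis insert_subset)
  have K: "K * mdist M y z \<le> max K L * mdist M y z" "L * mdist M y z \<le> max K L * mdist M y z"
    for y z by (auto intro: mult_right_mono)
  have "mdist N (f y) (f z) \<le> max K L * mdist M y z"
    if "x \<in> insert a X" "y \<in> mball_of M x (min r s)" "z \<in> mball_of M x (min r s)" for x y z
    using that 1(3)[of x y z] 2(3)[of y z] K[of y z] by (auto intro: order_trans)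
  moreover have "min r s > 0" "max K L > 0" using 1 2 by auto
  ultimately show ?case by blast
qed

section \<open>The induced map on finite subsets\<close>

text \<open>
  Taking the image may identify related pairs; this lowers both the sum of the distances and, by
  monotonicity, the weight.
\<close>

lemma rel_length_image_le:
  assumes \<omega>: "weight \<omega>" and R: "finite R" "R \<noteq> {}"
    and nonneg: "\<And>x y. 0 \<le> d' x y"
    and le: "\<And>x y. (x, y) \<in> R \<Longrightarrow> d' (f x) (f y) \<le> K * d x y"
  shows "rel_length \<omega> d' (map_prod f f ` R) \<le> K * rel_length \<omega> d R"
proof -
  have pos: "1 \<le> card (map_prod f f ` R)" "0 \<le> \<omega> (card R)"
    using R weight_ge_1[OF \<omega> R] by (auto simp: Suc_le_eq card_gt_0_iff)
  have "card (map_prod f f ` R) \<le> card R" using R(1) by (rule card_image_le)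
  then have \<omega>_le: "\<omega> (card (map_prod f f ` R)) \<le> \<omega> (card R)"
    using \<omega> pos by (auto simp: weight_def intro: mono_onD)
  have "(\<Sum>(x,y)\<in>map_prod f f ` R. d' x y) \<le> (\<Sum>(x,y)\<in>R. d' (f x) (f y))"
    using sum_image_le[OF R(1), of "\<lambda>(x,y). d' x y" "map_prod f f"] nonneg
    by (auto simp: case_prod_unfold o_def)
  also have "\<dots> \<le> (\<Sum>(x,y)\<in>R. K * d x y)"
    using le by (intro sum_mono) auto
  also have "\<dots> = K * (\<Sum>(x,y)\<in>R. d x y)"
    by (simp add: sum_distrib_left case_prod_unfold)
  finally have "rel_length \<omega> d' (map_prod f f ` R) \<le> \<omega> (card R) * (K * (\<Sum>(x,y)\<in>R. d x y))"
    unfolding rel_length_def using \<omega>_le pos nonneg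
    by (intro mult_mono sum_nonneg) auto
  then show ?thesis by (simp add: rel_length_def mult.left_commute)
qed

text \<open>
  The radii are chosen so that every point of a chain between \<open>Y\<close> and \<open>Z\<close> of length less than \<open>r / 2\<close>
  is within \<open>r / 4 + r / 2 < r\<close> of \<open>X\<close>.
\<close>

lemma ran_dist_image_le:
  assumes \<omega>: "weight \<omega>" and f: "f \<in> mspace M \<rightarrow> mspace N" and "0 < K"
    and Lip: "\<And>x y z. x \<in> X \<Longrightarrow> y \<in> mball_of M x r \<Longrightarrow> z \<in> mball_of M x r \<Longrightarrow>
           mdist N (f y) (f z) \<le> K * mdist M y z"
    and Y: "Y \<in> mball_of (ran_metric \<omega> M) X (r / 4)" and Z: "Z \<in> mball_of (ran_metric \<omega> M) X (r / 4)"
  shows "mdist (ran_metric \<omega> N) (f ` Y) (f ` Z) \<le> K * mdist (ran_metric \<omega> M) Y Z"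
proof -
  interpret M: Metric_space "mspace M" "mdist M" by simp
  interpret N: Metric_space "mspace N" "mdist N" by simp
  note ran = mspace_ran_metric[OF \<omega>] mdist_ran_metric[OF \<omega>]
  have XYZ: "X \<in> Ran (mspace M)" "Y \<in> Ran (mspace M)" "Z \<in> Ran (mspace M)"
    using Y Z by (auto simp: ran)
  have XY: "ran_dist \<omega> (mspace M) (mdist M) X Y < r / 4" using Y by (simp add: ran)
  have "mdist (ran_metric \<omega> M) Y Z \<le> mdist (ran_metric \<omega> M) Y X + mdist (ran_metric \<omega> M) X Z"
    using XYZ by (intro mdist_triangle) (auto simp: ran)
  then have YZ: "mdist (ran_metric \<omega> M) Y Z < r / 2"
    using Y Z by (simp add: mdist_commute)
  have chain: "mdist (ran_metric \<omega> N) (f ` Y) (f ` Z) \<le> K * chain_length \<omega> (mdist M) k Rs"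
    if c: "combinatorial_chain (mspace M) Y Z k Xs Rs" "chain_length \<omega> (mdist M) k Rs < r / 2"
    for k Xs Rs
  proof -
    have stretch: "mdist N (f u) (f v) \<le> K * mdist M u v" if "j < k" "(u, v) \<in> Rs j" for j u v
    proof -
      note step = combinatorial_chainD[OF c(1) \<open>j < k\<close>]
      have uv: "u \<in> Xs j" "v \<in> Xs (Suc j)" "u \<in> mspace M" "v \<in> mspace M"
        using step(1-3) that(2) by (auto simp: surjective_relation_def Ran_def)
      obtain y where y: "y \<in> Y" "mdist M y u \<le> chain_length \<omega> (mdist M) j Rs"
        using M.chain_traceback[OF \<omega> combinatorial_chain_prefix[OF c(1)] uv(1)] \<open>j < k\<close> by auto
      obtain x where x: "x \<in> X" "mdist M x y < r / 4"
        using M.ran_dist_less_imp_close[OF \<omega> XYZ(1,2) XY y(1)] by auto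
      have len: "chain_length \<omega> (mdist M) (Suc j) Rs < r / 2"
        using M.chain_length_mono[OF \<omega> c(1), of "Suc j"] \<open>j < k\<close> c(2) by simp
      have uv_le: "mdist M u v \<le> rel_length \<omega> (mdist M) (Rs j)"
        using M.dist_le_rel_length[OF \<omega> step(4) that(2)] .
      have mem: "x \<in> mspace M" "y \<in> mspace M" using x y XYZ by (auto simp: Ran_def)
      have "mdist M x u \<le> mdist M x y + mdist M y u" "mdist M x v \<le> mdist M x u + mdist M u v"
        using mem uv by (auto intro: mdist_triangle)
      moreover have "chain_length \<omega> (mdist M) (Suc j) Rs
          = chain_length \<omega> (mdist M) j Rs + rel_length \<omega> (mdist M) (Rs j)"
        by (simp add: chain_length_def)
      ultimately have "mdist M x v < r" "mdist M x u < r"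
        using x(2) y(2) len uv_le mdist_nonneg[of M u v] mdist_nonneg[of M x y] by linarith+
      then show ?thesis using mem uv x(1) by (intro Lip) auto
    qed
    have "mdist (ran_metric \<omega> N) (f ` Y) (f ` Z)
        \<le> chain_length \<omega> (mdist N) k (\<lambda>j. map_prod f f ` Rs j)"
      using N.ran_dist_le_chain_length[OF \<omega> combinatorial_chain_image[OF c(1) f]]
      by (simp add: mdist_ran_metric[OF \<omega>])
    also have "\<dots> \<le> (\<Sum>j<k. K * rel_length \<omega> (mdist M) (Rs j))"
      unfolding chain_length_def using stretch combinatorial_chainD(4,5)[OF c(1)]
      by (intro sum_mono rel_length_image_le[OF \<omega>]) auto
    finally show ?thesis by (simp add: chain_length_def sum_distrib_left)
  qed
  show ?thesis
  proof (rule ccontr)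
    assume "\<not> ?thesis"
    then have "mdist (ran_metric \<omega> M) Y Z < mdist (ran_metric \<omega> N) (f ` Y) (f ` Z) / K"
      using \<open>0 < K\<close> by (simp add: field_simps)
    with YZ have "ran_dist \<omega> (mspace M) (mdist M) Y Z
        < min (r / 2) (mdist (ran_metric \<omega> N) (f ` Y) (f ` Z) / K)"
      by (simp add: ran)
    then obtain k Xs Rs where c: "combinatorial_chain (mspace M) Y Z k Xs Rs"
      and len: "chain_length \<omega> (mdist M) k Rs
        < min (r / 2) (mdist (ran_metric \<omega> N) (f ` Y) (f ` Z) / K)"
      by (rule M.ran_dist_lessE[OF XYZ(2,3)])
    from len \<open>0 < K\<close> have "K * chain_length \<omega> (mdist M) k Rs < mdist (ran_metric \<omega> N) (f ` Y) (f ` Z)"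
      by (simp add: field_simps)
    with chain[OF c] len show False by simp
  qed
qed

lemma ran_map_in_lip_hom:
  assumes \<omega>: "weight \<omega>" and f: "f \<in> lip_hom M N"
  shows "ran_map M f \<in> lip_hom (ran_metric \<omega> M) (ran_metric \<omega> N)"
proof -
  have maps: "f \<in> mspace M \<rightarrow> mspace N" and loc: "locally_Lipschitz_map M N f"
    using f by (auto simp: lip_hom_def)
  have ran_maps: "ran_map M f \<in> mspace (ran_metric \<omega> M) \<rightarrow>\<^sub>E mspace (ran_metric \<omega> N)"
    using maps by (auto simp: ran_map_def mspace_ran_metric[OF \<omega>] Ran_def)
  have "\<exists>r>0. \<exists>K>0. \<forall>Y\<in>mball_of (ran_metric \<omega> M) X r. \<forall>Z\<in>mball_of (ran_metric \<omega> M) X r.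
      mdist (ran_metric \<omega> N) (ran_map M f Y) (ran_map M f Z) \<le> K * mdist (ran_metric \<omega> M) Y Z"
    if "X \<in> mspace (ran_metric \<omega> M)" for X
  proof -
    have "finite X" "X \<subseteq> mspace M" using that by (auto simp: mspace_ran_metric[OF \<omega>] Ran_def)
    then obtain r K where rK: "r > 0" "K > 0"
      "\<And>x y z. x \<in> X \<Longrightarrow> y \<in> mball_of M x r \<Longrightarrow> z \<in> mball_of M x r \<Longrightarrow>
         mdist N (f y) (f z) \<le> K * mdist M y z"
      using locally_Lipschitz_map_finite_uniform[OF loc] by meson
    have "mdist (ran_metric \<omega> N) (ran_map M f Y) (ran_map M f Z) \<le> K * mdist (ran_metric \<omega> M) Y Z"
      if "Y \<in> mball_of (ran_metric \<omega> M) X (r / 4)" "Z \<in> mball_of (ran_metric \<omega> M) X (r / 4)" for Y Z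
      using ran_dist_image_le[OF \<omega> maps rK(2,3) that] that
      by (simp add: ran_map_def mspace_ran_metric[OF \<omega>])
    moreover have "r / 4 > 0" using rK(1) by simp
    ultimately show ?thesis using rK(2) by blast
  qed
  then show ?thesis
    using ran_maps by (auto simp: lip_hom_def locally_Lipschitz_map_iff_mball)
qed

lemma ran_map_ident: "ran_map M (\<lambda>x\<in>mspace M. x) = (\<lambda>X\<in>Ran (mspace M). X)"
proof -
  have "(\<lambda>x\<in>mspace M. x) ` X = X" if "X \<subseteq> mspace M" for X
    using that by (force simp: image_iff)
  then show ?thesis by (auto simp: ran_map_def Ran_def intro!: restrict_ext)
qed

lemma ran_map_compose:
  assumes "f \<in> mspace M \<rightarrow> mspace N"
  shows "ran_map M (compose (mspace M) g f) = compose (Ran (mspace M)) (ran_map N g) (ran_map M f)"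
proof
  fix X
  show "ran_map M (compose (mspace M) g f) X
      = compose (Ran (mspace M)) (ran_map N g) (ran_map M f) X"
  proof (cases "X \<in> Ran (mspace M)")
    case True
    then have "X \<subseteq> mspace M" "f ` X \<in> Ran (mspace N)"
      using assms by (auto simp: Ran_def)
    then have "compose (mspace M) g f ` X = g ` f ` X"
      by (force simp: compose_def image_image)
    then show ?thesis
      using True \<open>f ` X \<in> Ran (mspace N)\<close> by (simp add: ran_map_def compose_def)
  qed (simp add: ran_map_def compose_def)
qed

lemma card_ran_map:
  assumes "inj_on f (mspace M)" "X \<in> Ran (mspace M)"
  shows "card (ran_map M f X) = card X"
  using assms by (auto simp: ran_map_def Ran_def intro!: card_image intro: inj_on_subset)

theorem theorem8:
  fixes \<omega> :: "nat \<Rightarrow> real"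
    and M :: "'a metric" and N :: "'b metric" and P :: "'c metric"
  assumes "weight \<omega>"
  shows
    "((\<lambda>x\<in>mspace M. x) \<in> lip_hom M M \<and>
      (\<forall>f\<in>lip_hom M N. \<forall>g\<in>lip_hom N P. compose (mspace M) g f \<in> lip_hom M P)) \<and>
     Metric_space (Ran (mspace M)) (ran_dist \<omega> (mspace M) (mdist M)) \<and>
     (\<forall>f\<in>lip_hom M N. ran_map M f \<in> lip_hom (ran_metric \<omega> M) (ran_metric \<omega> N)) \<and>
     ran_map M (\<lambda>x\<in>mspace M. x) = (\<lambda>X\<in>mspace (ran_metric \<omega> M). X) \<and>
     (\<forall>f\<in>lip_hom M N. \<forall>g\<in>lip_hom N P.
        ran_map M (compose (mspace M) g f)
          = compose (mspace (ran_metric \<omega> M)) (ran_map N g) (ran_map M f)) \<and>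
     (\<forall>f\<in>lip_hom M N. inj_on f (mspace M) \<longrightarrow>
        (\<forall>X\<in>Ran (mspace M). card (ran_map M f X) = card X))"
proof (intro conjI ballI impI)
  fix f g assume f: "f \<in> lip_hom M N" and g: "g \<in> lip_hom N P"
  show "compose (mspace M) g f \<in> lip_hom M P"
    using f g by (rule lip_hom_compose)
  have "f \<in> mspace M \<rightarrow> mspace N" using f by (auto simp: lip_hom_def)
  then show "ran_map M (compose (mspace M) g f)
      = compose (mspace (ran_metric \<omega> M)) (ran_map N g) (ran_map M f)"
    by (simp add: ran_map_compose mspace_ran_metric assms)
next
  show "Metric_space (Ran (mspace M)) (ran_dist \<omega> (mspace M) (mdist M))"
    using assms by (intro Metric_space.Metric_space_ran_dist) auto
qed (simp_all add: lip_hom_ident ran_map_in_lip_hom ran_map_ident mspace_ran_metric card_ran_map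
      assms)

end
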